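(* Let $k$, $n$ and $s$ be positive integers, let $x_1,\ldots,x_n$ be independent variables, and write $p_k=\sum_{i=1}^n x_i^k$, $E_i^{(s)}=E_i^{(s)}(x_1,\ldots,x_n)$, $H_i^{(s)}=H_i^{(s)}(x_1,\ldots,x_n)$. Then, with all sums over tuples of nonnegative integers $(t_1,t_2,\ldots)$ satisfying the indicated weighted-sum condition, $$p_k=\frac{\displaystyle\sum_{t_1+2t_2+\cdots+kt_k=k}\frac{(-1)^{t_1+\cdots+t_k}}{t_1+\cdots+t_k}\binom{t_1+\cdots+t_k}{t_1,\ldots,t_k}\prod_{i=1}^k\big(E_i^{(s)}\big)^{t_i}}{\displaystyle\sum_{t_1+2t_2+\cdots+st_s=k}\frac{(-1)^{t_1+\cdots+t_s}}{t_1+\cdots+t_s}\binom{t_1+\cdots+t_s}{t_1,\ldots,t_s}}$$ and $$p_k=\frac{\displaystyle\sum_{t_1+2t_2+\cdots+kt_k=k}\frac{(-1)^{1+t_1+\cdots+t_k}}{t_1+\cdots+t_k}\binom{t_1+\cdots+t_k}{t_1,\ldots,t_k}\prod_{i=1}^k\big(H_i^{(s)}\big)^{t_i}}{\displaystyle\sum_{t_1+2t_2+\cdots+st_s=k}\frac{(-1)^{k+t_1+\cdots+t_s}}{t_1+\cdots+t_s}\binom{t_1+\cdots+t_s}{t_1,\ldots,t_s}}.$$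
   Context: For a positive integer $s$, $H_k^{(s)}$ and $E_k^{(s)}$ ($k\ge0$) are defined by the formal power series identities $$\sum_{k\ge0}H_k^{(s)}(x_1,\ldots,x_n)t^k=\prod_{i=1}^n\big(1-x_it+\cdots+(-x_it)^s\big)^{-1},\qquad \sum_{k\ge0}E_k^{(s)}(x_1,\ldots,x_n)t^k=\prod_{i=1}^n\big(1+x_it+\cdots+(x_it)^s\big).$$ $\binom{t_1+\cdots+t_m}{t_1,\ldots,t_m}$ denotes the multinomial coefficient. *)

theory Defs
  imports
    "HOL-Library.Poly_Mapping"
    "HOL-Library.FuncSet"
    "HOL-Computational_Algebra.Computational_Algebra"
begin

text \<open>
  The field of rational functions over \<^typ>\<open>'a\<close> in countably many independent variables: a
  polynomial assigns coefficients to exponent vectors, which are finitely supported maps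
  \<^typ>\<open>nat \<Rightarrow>\<^sub>0 nat\<close>. The variables \<open>x\<^sub>1, \<dots>, x\<^sub>n\<close> are \<open>indet 1, \<dots>, indet n\<close>.
\<close>

type_synonym 'a ratfun = "((nat \<Rightarrow>\<^sub>0 nat) \<Rightarrow>\<^sub>0 'a) fract"

definition indet :: "nat \<Rightarrow> 'a::field ratfun" where
  "indet i = Fraction_Field.Fract (Poly_Mapping.single (Poly_Mapping.single i 1) 1) 1"

definition Epoly :: "nat \<Rightarrow> nat \<Rightarrow> (nat \<Rightarrow> 'b::field) \<Rightarrow> nat \<Rightarrow> 'b" where
  "Epoly s n x k =
     fps_nth (\<Prod>i=1..n. \<Sum>j=0..s. (fps_const (x i) * fps_X) ^ j) k"

text \<open>The inverse below is a genuine one: the inner sums have constant term 1.\<close>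

definition Hpoly :: "nat \<Rightarrow> nat \<Rightarrow> (nat \<Rightarrow> 'b::field) \<Rightarrow> nat \<Rightarrow> 'b" where
  "Hpoly s n x k =
     fps_nth (\<Prod>i=1..n. inverse (\<Sum>j=0..s. (- (fps_const (x i) * fps_X)) ^ j)) k"

text \<open>Tuples \<open>(t\<^sub>1, \<dots>, t\<^sub>m)\<close> of naturals with \<open>t\<^sub>1 + 2 t\<^sub>2 + \<dots> + m t\<^sub>m = k\<close>.\<close>

definition wtuples :: "nat \<Rightarrow> nat \<Rightarrow> (nat \<Rightarrow> nat) set" where
  "wtuples m k = {t \<in> {1..m} \<rightarrow>\<^sub>E UNIV. (\<Sum>i=1..m. i * t i) = k}"

definition tsum :: "nat \<Rightarrow> (nat \<Rightarrow> nat) \<Rightarrow> nat" where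
  "tsum m t = (\<Sum>i=1..m. t i)"

definition multinom :: "nat \<Rightarrow> (nat \<Rightarrow> nat) \<Rightarrow> nat" where
  "multinom m t = fact (tsum m t) div (\<Prod>i=1..m. fact (t i))"

text \<open>The sums over \<^const>\<open>wtuples\<close> are finite, and the division in \<^const>\<open>multinom\<close> is exact.\<close>

lemma finite_wtuples: "finite (wtuples m k)"
proof (rule finite_subset)
  show "wtuples m k \<subseteq> {1..m} \<rightarrow>\<^sub>E {..k}"
  proof
    fix t assume t: "t \<in> wtuples m k"
    have "t i \<le> k" if i: "i \<in> {1..m}" for i
    proof -
      have "t i \<le> i * t i" using i by simp
      also have "\<dots> \<le> (\<Sum>i=1..m. i * t i)"
        by (rule member_le_sum[OF i]) auto
      finally show ?thesis using t by (simp add: wtuples_def)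
    qed
    then show "t \<in> {1..m} \<rightarrow>\<^sub>E {..k}"
      using t by (auto simp: wtuples_def PiE_def)
  qed
  show "finite ({1..m} \<rightarrow>\<^sub>E {..k})" by (intro finite_PiE) auto
qed

lemma multinom_exact: "multinom m t * (\<Prod>i=1..m. fact (t i)) = fact (tsum m t)"
proof -
  have "(\<Prod>i=1..m. fact (t i)) dvd (fact (tsum m t) :: nat)"
  proof (induction m)
    case (Suc m)
    have "(\<Prod>i=1..Suc m. fact (t i)) dvd fact (tsum m t) * (fact (t (Suc m)) :: nat)"
      using Suc by (simp add: mult_dvd_mono)
    also have "\<dots> dvd fact (tsum (Suc m) t)"
      by (simp add: tsum_def fact_fact_dvd_fact)
    finally show ?case .
  qed (simp add: tsum_def)
  then show ?thesis by (simp add: multinom_def)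
qed

end

theory Submission
  imports Defs
begin

text \<open>
  Up to sign, the sums over weighted tuples are the coefficients of the formal logarithm of the
  generating function, expanded by the multinomial theorem. The logarithm turns the product
  defining \<open>E\<close> into a sum of the series \<open>ln G(x\<^sub>i X)\<close> with \<open>G = 1 + X + \<dots> + X\<^sup>s\<close>, whose \<open>k\<close>-th
  coefficient is \<open>x\<^sub>i\<^sup>k\<close> times that of \<open>ln G\<close>; the same holds for \<open>H\<close> with \<open>-x\<^sub>i\<close> in place of
  \<open>x\<^sub>i\<close>, up to sign. Since \<open>ln G = ln (1 - X\<^sup>s\<^sup>+\<^sup>1) - ln (1 - X)\<close>, the \<open>k\<close>-th coefficient of \<open>ln G\<close> is \<open>-s/k\<close> or
  \<open>1/k\<close> according to whether \<open>s + 1\<close> divides \<open>k\<close>, and in characteristic zero it never vanishes.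
\<close>

text \<open>The embedding of a domain into its fraction field is injective, so characteristic zero
  carries over to \<open>ratfun\<close>, where the logarithm has to divide by positive
  integers.\<close>

instance fract :: ("{idom, ring_char_0}") field_char_0
proof
  show "inj (of_nat :: nat \<Rightarrow> 'a fract)"
    by (rule injI) (simp add: of_nat_fract eq_fract)
qed

section \<open>The multinomial theorem\<close>

lemma tsum_upd: "tsum (Suc m) (t(Suc m := c)) = tsum m t + c"
  by (simp add: tsum_def)

text \<open>Multiplied by all the factorials, both sides become \<open>fact (tsum m t + c)\<close>.
  This recursion drives the induction in \<open>multinomial_theorem\<close>.\<close>

lemma multinom_upd:
  "multinom (Suc m) (t(Suc m := c)) = (tsum m t + c choose tsum m t) * multinom m t"
proof -
  let ?P = "(\<Prod>i=1..m. fact (t i)) :: nat"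
  have "multinom (Suc m) (t(Suc m := c)) * (?P * fact c) = fact (tsum m t + c)"
    using multinom_exact[of "Suc m" "t(Suc m := c)"] by (simp add: tsum_upd)
  also have "\<dots> = fact (tsum m t) * fact c * (tsum m t + c choose tsum m t)"
    using binomial_fact_lemma[of "tsum m t" "tsum m t + c"] by simp
  also have "\<dots> = (tsum m t + c choose tsum m t) * multinom m t * (?P * fact c)"
    by (simp flip: multinom_exact[of m t])
  finally show ?thesis by simp
qed

lemma finite_tsum_eq: "finite {t :: nat \<Rightarrow> nat. t \<in> {1..m} \<rightarrow>\<^sub>E UNIV \<and> tsum m t = d}"
proof (rule finite_subset)
  show "{t :: nat \<Rightarrow> nat. t \<in> {1..m} \<rightarrow>\<^sub>E UNIV \<and> tsum m t = d} \<subseteq> {1..m} \<rightarrow>\<^sub>E {..d}"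
    by (auto simp: tsum_def PiE_def intro!: member_le_sum)
qed (intro finite_PiE, auto)

lemma multinomial_theorem:
  fixes a :: "nat \<Rightarrow> 'a::comm_semiring_1"
  shows "(\<Sum>i=1..m. a i) ^ d =
    (\<Sum>t | t \<in> {1..m} \<rightarrow>\<^sub>E UNIV \<and> tsum m t = d. of_nat (multinom m t) * (\<Prod>i=1..m. a i ^ t i))"
proof (induction m arbitrary: d)
  case 0
  have "{t :: nat \<Rightarrow> nat. t \<in> {1..0} \<rightarrow>\<^sub>E UNIV \<and> tsum 0 t = d} = (if d = 0 then {\<lambda>_. undefined} else {})"
    by (auto simp: tsum_def)
  then show ?case by (simp add: multinom_def tsum_def power_0_left)
next
  case (Suc m)
  define T where "T m d = {t :: nat \<Rightarrow> nat. t \<in> {1..m} \<rightarrow>\<^sub>E UNIV \<and> tsum m t = d}" for m d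
  define g where "g m t = of_nat (multinom m t) * (\<Prod>i=1..m. a i ^ t i)" for m t
  have finT: "finite (T m j)" for j
    unfolding T_def by (rule finite_tsum_eq)
  have g_upd: "g (Suc m) (t(Suc m := c)) =
      of_nat (tsum m t + c choose tsum m t) * g m t * a (Suc m) ^ c" for t c
    unfolding g_def multinom_upd by (simp add: mult.assoc)
  have "(\<Sum>i=1..Suc m. a i) ^ d = ((\<Sum>i=1..m. a i) + a (Suc m)) ^ d"
    by simp
  also have "\<dots> = (\<Sum>j\<le>d. of_nat (d choose j) * (\<Sum>t\<in>T m j. g m t) * a (Suc m) ^ (d - j))"
    unfolding binomial_ring Suc.IH T_def g_def ..
  also have "\<dots> = (\<Sum>j\<le>d. \<Sum>t\<in>T m j. of_nat (d choose j) * g m t * a (Suc m) ^ (d - j))"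
    by (simp add: sum_distrib_left sum_distrib_right)
  also have "\<dots> = (\<Sum>(j, t)\<in>Sigma {..d} (T m). of_nat (d choose j) * g m t * a (Suc m) ^ (d - j))"
    by (rule sum.Sigma) (auto simp: finT)
  also have "\<dots> = (\<Sum>t\<in>T (Suc m) d. g (Suc m) t)"
  \<comment> \<open>A tuple of total \<open>d\<close> is determined by its first \<open>m\<close>
    entries, of total \<open>j\<close>: the last one must be \<open>d - j\<close>. Resetting it to
    \<open>undefined\<close> makes the shortened tuple extensional again.\<close>
  proof (rule sum.reindex_bij_witness[where
        j = "\<lambda>(j, t). t(Suc m := d - j)" and i = "\<lambda>t. (tsum m t, t(Suc m := undefined))"], goal_cases)
    case (1 p)
    then show ?case by (auto simp: T_def tsum_def PiE_def extensional_def fun_eq_iff)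
  next
    case (2 p)
    then show ?case by (auto simp: T_def tsum_def PiE_def extensional_def)
  next
    case (3 t)
    then have "t (Suc m) = d - tsum m t" by (auto simp: T_def tsum_def)
    then show ?case by (auto simp: fun_eq_iff)
  next
    case (4 t)
    then show ?case by (auto simp: T_def tsum_def PiE_def extensional_def)
  next
    case (5 p)
    obtain j t where p: "p = (j, t)" "j \<le> d" "tsum m t = j"
      using 5 by (auto simp: T_def)
    then show ?case using g_upd[of t "d - j"] by simp
  qed
  finally show ?case by (simp add: T_def g_def)
qed

section \<open>The formal logarithm\<close>

text \<open>Since \<open>fps_ln 1\<close> is the series of ln(1 + X), this is ln F whenever
  \<open>F $ 0 = 1\<close>.\<close>

definition fps_log :: "'a::field_char_0 fps \<Rightarrow> 'a fps" where
  "fps_log F = fps_ln 1 oo (F - 1)"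

lemma fps_log_nth_0 [simp]: "fps_log F $ 0 = 0"
  by (simp add: fps_log_def)

lemma fps_log_one [simp]: "fps_log 1 = 0"
  by (simp add: fps_log_def)

lemma fps_log_deriv:
  assumes "F $ 0 = 1"
  shows "fps_deriv (fps_log F) = inverse F * fps_deriv F"
proof -
  have "inverse (1 + fps_X) oo (F - 1) = inverse F"
    using assms by (simp add: fps_inverse_compose fps_compose_add_distrib)
  then show ?thesis
    using assms by (simp add: fps_log_def fps_compose_deriv fps_ln_deriv)
qed

text \<open>Both sides have the same derivative and constant term 0, which determines a series in
  characteristic zero.\<close>

lemma fps_log_mult:
  assumes "F $ 0 = 1" "G $ 0 = 1"
  shows "fps_log (F * G) = fps_log F + fps_log G"
proof -
  have F: "inverse F * F = 1" and G: "inverse G * G = 1"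
    using assms by (auto intro: inverse_mult_eq_1)
  have "fps_deriv (fps_log (F * G)) =
      (inverse G * G) * (inverse F * fps_deriv F) + (inverse F * F) * (inverse G * fps_deriv G)"
    using assms by (simp add: fps_log_deriv fps_inverse_mult algebra_simps)
  also have "\<dots> = fps_deriv (fps_log F + fps_log G)"
    using assms F G by (simp add: fps_log_deriv)
  finally show ?thesis by (simp only: fps_deriv_eq_iff) simp
qed

lemma fps_log_inverse:
  assumes "F $ 0 = 1"
  shows "fps_log (inverse F) = - fps_log F"
proof -
  have "fps_log (inverse F) + fps_log F = fps_log (inverse F * F)"
    using assms by (simp add: fps_log_mult)
  also have "inverse F * F = 1"
    using assms by (intro inverse_mult_eq_1) auto
  finally show ?thesis by (simp add: eq_neg_iff_add_eq_0)
qed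

lemma fps_nth_0_prod: "(\<Prod>i\<in>A. F i) $ 0 = (\<Prod>i\<in>A. F i $ 0 :: 'a::comm_ring_1)"
  by (induction A rule: infinite_finite_induct) simp_all

lemma fps_log_prod:
  assumes "\<And>i. i \<in> A \<Longrightarrow> F i $ 0 = 1"
  shows "fps_log (\<Prod>i\<in>A. F i) = (\<Sum>i\<in>A. fps_log (F i))"
  using assms
  by (induction A rule: infinite_finite_induct) (simp_all add: fps_log_mult fps_nth_0_prod)

lemma fps_log_compose:
  assumes "F $ 0 = 1" "G $ 0 = 0"
  shows "fps_log (F oo G) = fps_log F oo G"
  using assms fps_compose_assoc[of G "F - 1" "fps_ln 1"]
  by (simp add: fps_log_def fps_compose_sub_distrib)

lemma fps_log_one_minus_X:
  "fps_log (1 - fps_X) $ k = (if k = 0 then 0 else - 1 / of_nat k :: 'a::field_char_0)"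
proof (cases k)
  case (Suc l)
  \<comment> \<open>The first sign comes from substituting -X, the second from the coefficient of
    ln(1 + X) at \<open>Suc l\<close>.\<close>
  have "(-1) ^ Suc l * (-1) ^ l = (-1 :: 'a)"
    by (simp flip: power_mult_distrib)
  with Suc show ?thesis
    by (simp add: fps_log_def fps_compose_uminus' fps_ln_nth del: of_nat_Suc)
qed simp

section \<open>Logarithms as sums over weighted tuples\<close>

lemma fps_power_nth_cong:
  assumes "\<And>j. j \<le> k \<Longrightarrow> f $ j = g $ j"
  shows "(f ^ d) $ k = (g ^ d) $ k"
proof -
  have "\<forall>j\<le>k. (f ^ d) $ j = (g ^ d) $ j"
  proof (induction d)
    case (Suc d)
    then show ?case using assms by (auto simp: fps_mult_nth intro!: sum.cong)
  qed simp
  then show ?thesis by simp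
qed

lemma wtuples_tsum_le: "t \<in> wtuples m k \<Longrightarrow> tsum m t \<le> k"
  unfolding wtuples_def tsum_def by (auto intro!: sum_mono)

text \<open>In the multinomial expansion a tuple \<open>t\<close> contributes a multiple of X to the
  power \<open>\<Sum>i=1..m. i * t i\<close>, so extracting the coefficient at \<open>k\<close>
  imposes the weight condition.\<close>

lemma fps_polynomial_power_nth:
  fixes b :: "nat \<Rightarrow> 'a::comm_ring_1"
  shows "((\<Sum>i=1..m. fps_const (b i) * fps_X ^ i) ^ d) $ k =
    (\<Sum>t | t \<in> wtuples m k \<and> tsum m t = d. of_nat (multinom m t) * (\<Prod>i=1..m. b i ^ t i))"
proof -
  define T where "T = {t :: nat \<Rightarrow> nat. t \<in> {1..m} \<rightarrow>\<^sub>E UNIV \<and> tsum m t = d}"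
  have finT: "finite T"
    unfolding T_def by (rule finite_tsum_eq)
  have prod_eq: "(\<Prod>i=1..m. (fps_const (b i) * fps_X ^ i) ^ t i) =
      fps_const (\<Prod>i=1..m. b i ^ t i) * fps_X ^ (\<Sum>i=1..m. i * t i)" for t
    by (induction m) (simp_all add: power_mult_distrib power_mult power_add fps_const_power
        flip: fps_const_mult)
  have "((\<Sum>i=1..m. fps_const (b i) * fps_X ^ i) ^ d) $ k =
      (\<Sum>t\<in>T. if (\<Sum>i=1..m. i * t i) = k
        then of_nat (multinom m t) * (\<Prod>i=1..m. b i ^ t i) else 0)"
    unfolding multinomial_theorem T_def[symmetric] fps_sum_nth prod_eq
    by (intro sum.cong refl) (auto simp flip: fps_of_nat mult.assoc)
  also have "\<dots> = (\<Sum>t\<in>{t\<in>T. (\<Sum>i=1..m. i * t i) = k}.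
      of_nat (multinom m t) * (\<Prod>i=1..m. b i ^ t i))"
    using finT by (rule sum.inter_filter[symmetric])
  also have "{t\<in>T. (\<Sum>i=1..m. i * t i) = k} = {t. t \<in> wtuples m k \<and> tsum m t = d}"
    by (auto simp: T_def wtuples_def)
  finally show ?thesis .
qed

text \<open>The series of ln F in powers of F - 1 is expanded with tuples grouped by
  \<open>tsum\<close>. Only coefficients up to \<open>k\<close> matter, so one statement covers the
  numerators (\<open>m = k\<close>) and the denominators (\<open>m = s\<close>, all
  \<open>b j = 1\<close>).\<close>

lemma wtuples_sum_eq_fps_log:
  fixes F :: "'a::field_char_0 fps"
  assumes F0: "F $ 0 = 1"
    and Fm: "\<And>j. 1 \<le> j \<Longrightarrow> j \<le> k \<Longrightarrow> F $ j = (if j \<le> m then b j else 0)"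
  shows "(\<Sum>t\<in>wtuples m k. (-1) ^ tsum m t / of_nat (tsum m t) * of_nat (multinom m t)
      * (\<Prod>i=1..m. b i ^ t i)) = - fps_log F $ k"
proof -
  let ?P = "\<Sum>i=1..m. fps_const (b i) * fps_X ^ i"
  let ?c = "\<lambda>d. (-1) ^ d / of_nat d :: 'a"
  let ?g = "\<lambda>t. of_nat (multinom m t) * (\<Prod>i=1..m. b i ^ t i)"
  have P: "(F - 1) $ j = ?P $ j" if "j \<le> k" for j
  proof (cases "j = 0")
    case True
    then show ?thesis by (auto simp: F0 fps_sum_nth intro!: sum.neutral)
  next
    case False
    have "?P $ j = (\<Sum>i=1..m. if i = j then b i else 0)"
      unfolding fps_sum_nth by (intro sum.cong) auto
    then show ?thesis using False Fm that by simp
  qed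
  have "- fps_log F $ k = (\<Sum>d=0..k. ?c d * ((F - 1) ^ d) $ k)"
    unfolding fps_log_def fps_neg_nth fps_compose_nth sum_negf[symmetric]
  proof (intro sum.cong refl)
    \<comment> \<open>At \<open>d = 0\<close> both sides vanish, because division by zero yields
      zero.\<close>
    fix d show "- (fps_ln 1 $ d * ((F - 1) ^ d) $ k) = ?c d * ((F - 1) ^ d) $ k"
      by (cases d) (simp_all add: fps_ln_nth)
  qed
  also have "\<dots> = (\<Sum>d=0..k. ?c d * (?P ^ d) $ k)"
    by (intro sum.cong refl arg_cong2[where f = "(*)"] fps_power_nth_cong P)
  also have "\<dots> = (\<Sum>d=0..k. \<Sum>t | t \<in> wtuples m k \<and> tsum m t = d. ?c (tsum m t) * ?g t)"
    unfolding fps_polynomial_power_nth sum_distrib_left by simp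
  also have "\<dots> = (\<Sum>t\<in>wtuples m k. ?c (tsum m t) * ?g t)"
    by (rule sum.group) (auto simp: finite_wtuples wtuples_tsum_le)
  finally show ?thesis by (simp add: mult.assoc)
qed

section \<open>The truncated geometric series\<close>

definition fps_geom :: "nat \<Rightarrow> 'a::field fps" where
  "fps_geom s = (\<Sum>j=0..s. fps_X ^ j)"

lemma fps_geom_nth: "fps_geom s $ k = (if k \<le> s then 1 else 0)"
  by (simp add: fps_geom_def fps_sum_nth)

lemma fps_geom_compose:
  "fps_geom s oo (fps_const c * fps_X) = (\<Sum>j=0..s. (fps_const c * fps_X) ^ j)"
  unfolding fps_geom_def fps_compose_sum_distrib
  by (intro sum.cong refl, subst fps_compose_power[symmetric]) simp_all

text \<open>The logarithm commutes with the substitution of cX for X. The factor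
  \<open>c ^ k\<close> is the source of the power sums.\<close>

lemma fps_log_geom_scaled_nth:
  "fps_log (\<Sum>j=0..s. (fps_const c * fps_X) ^ j) $ k = c ^ k * fps_log (fps_geom s) $ k"
  unfolding fps_geom_compose[symmetric]
  by (subst fps_log_compose) (simp_all add: fps_geom_nth fps_compose_linear)

lemma fps_log_geom_nth:
  assumes "k \<ge> 1"
  shows "fps_log (fps_geom s) $ k =
    (if Suc s dvd k then - of_nat s / of_nat k else 1 / of_nat k :: 'a::field_char_0)"
proof -
  have "(1 - fps_X) * fps_geom s = (1 - fps_X ^ Suc s :: 'a fps)"
    using sum_gp_basic[of "fps_X :: 'a fps" s] by (simp add: fps_geom_def atLeast0AtMost)
  \<comment> \<open>In this form the logarithm is that of 1 - X with its coefficients moved to the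
    multiples of \<open>Suc s\<close>.\<close>
  also have "\<dots> = (1 - fps_X) oo fps_X ^ Suc s"
    by (simp add: fps_compose_sub_distrib)
  finally have "fps_log (1 - fps_X) + fps_log (fps_geom s) = (fps_log (1 - fps_X) oo fps_X ^ Suc s :: 'a fps)"
    by (simp add: fps_geom_nth flip: fps_log_mult fps_log_compose)
  then have "fps_log (fps_geom s) $ k =
      (fps_log (1 - fps_X) oo fps_X ^ Suc s) $ k - (fps_log (1 - fps_X) $ k :: 'a)"
    by (metis add_diff_cancel_left' fps_sub_nth)
  also have "(fps_log (1 - fps_X) oo fps_X ^ Suc s) $ k =
      (if Suc s dvd k then fps_log (1 - fps_X) $ (k div Suc s) else 0 :: 'a)"
    by (rule fps_nth_compose_X_power)
  finally have eq: "fps_log (fps_geom s) $ k =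
      (if Suc s dvd k then fps_log (1 - fps_X) $ (k div Suc s) else 0) - (fps_log (1 - fps_X) $ k :: 'a)" .
  show ?thesis
  proof (cases "Suc s dvd k")
    case True
    then obtain l where l: "k = Suc s * l" ..
    have "k div Suc s = l" "l \<noteq> 0"
      unfolding l using assms l by (simp_all del: mult_Suc)
    moreover have "of_nat (Suc s) \<noteq> (0 :: 'a)"
      by (rule of_nat_neq_0)
    \<comment> \<open>This is -1/l + 1/k over the common denominator \<open>k = Suc s * l\<close>;
      the numerator equals -s.\<close>
    ultimately have "fps_log (fps_geom s) $ k = (1 - of_nat (Suc s)) / (of_nat (Suc s) * of_nat l :: 'a)"
      using assms True unfolding eq
      by (simp add: fps_log_one_minus_X l diff_divide_distrib del: of_nat_Suc mult_Suc)
    then show ?thesis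
      using True by (simp add: l del: mult_Suc)
  next
    case False
    then show ?thesis
      using assms unfolding eq by (simp add: fps_log_one_minus_X)
  qed
qed

section \<open>Power sums\<close>

lemma fps_geom_scaled_nth_0: "(\<Sum>j=0..s. (fps_const c * fps_X) ^ j) $ 0 = (1 :: 'a::field)"
  unfolding fps_geom_compose[symmetric] by (simp add: fps_geom_nth)

lemma Epoly_sum_eq:
  fixes x :: "nat \<Rightarrow> 'a::field_char_0"
  shows "(\<Sum>t\<in>wtuples k k. (-1) ^ tsum k t / of_nat (tsum k t) * of_nat (multinom k t)
      * (\<Prod>i=1..k. Epoly s n x i ^ t i)) = - ((\<Sum>i=1..n. x i ^ k) * fps_log (fps_geom s) $ k)"
proof -
  let ?E = "\<Prod>i=1..n. \<Sum>j=0..s. (fps_const (x i) * fps_X) ^ j"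
  have "fps_log ?E = (\<Sum>i=1..n. fps_log (\<Sum>j=0..s. (fps_const (x i) * fps_X) ^ j))"
    by (rule fps_log_prod) (rule fps_geom_scaled_nth_0)
  then have "fps_log ?E $ k = (\<Sum>i=1..n. x i ^ k) * fps_log (fps_geom s) $ k"
    by (simp only: fps_sum_nth[of _ "{1..n}"] fps_log_geom_scaled_nth sum_distrib_right)
  moreover have "?E $ 0 = 1"
    by (simp only: fps_nth_0_prod fps_geom_scaled_nth_0 prod.neutral_const)
  ultimately show ?thesis
    by (subst wtuples_sum_eq_fps_log[where F = ?E]) (simp_all add: Epoly_def)
qed

text \<open>Two signs differ from \<open>Epoly_sum_eq\<close>: the inverse negates the logarithm,
  and \<open>- x i\<close> in place of \<open>x i\<close> contributes
  \<open>(-1) ^ k\<close>.\<close>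

lemma Hpoly_sum_eq:
  fixes x :: "nat \<Rightarrow> 'a::field_char_0"
  shows "(\<Sum>t\<in>wtuples k k. (-1) ^ tsum k t / of_nat (tsum k t) * of_nat (multinom k t)
      * (\<Prod>i=1..k. Hpoly s n x i ^ t i)) = (-1) ^ k * (\<Sum>i=1..n. x i ^ k) * fps_log (fps_geom s) $ k"
proof -
  let ?G = "\<lambda>i. \<Sum>j=0..s. (- (fps_const (x i) * fps_X)) ^ j"
  let ?H = "\<Prod>i=1..n. inverse (?G i)"
  have G: "?G i = (\<Sum>j=0..s. (fps_const (- x i) * fps_X) ^ j)" for i
    by (simp flip: fps_const_neg)
  have G0: "?G i $ 0 = 1" for i
    unfolding G by (rule fps_geom_scaled_nth_0)
  have "fps_log (inverse (?G i)) $ k = - ((-1) ^ k * x i ^ k * fps_log (fps_geom s) $ k)" for i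
    unfolding fps_log_inverse[OF G0] unfolding G
    by (simp only: fps_neg_nth fps_log_geom_scaled_nth power_minus[of "x i"])
  moreover have "fps_log ?H = (\<Sum>i=1..n. fps_log (inverse (?G i)))"
    by (rule fps_log_prod) (simp only: fps_inverse_nth_0 G0 inverse_1)
  ultimately have "fps_log ?H $ k = - ((-1) ^ k * (\<Sum>i=1..n. x i ^ k) * fps_log (fps_geom s) $ k)"
    by (simp add: fps_sum_nth sum_negf sum_distrib_left sum_distrib_right)
  moreover have "?H $ 0 = 1"
    by (simp only: fps_nth_0_prod fps_inverse_nth_0 G0 inverse_1 prod.neutral_const)
  ultimately show ?thesis
    by (subst wtuples_sum_eq_fps_log[where F = ?H]) (simp_all add: Hpoly_def)
qed

theorem theorem2p5:
  fixes k n s :: nat and x :: "nat \<Rightarrow> 'a::field_char_0 ratfun"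
  assumes "k \<ge> 1" and "n \<ge> 1" and "s \<ge> 1"
    and indep: "x = indet"
  shows "(\<Sum>i=1..n. x i ^ k) =
      (\<Sum>t\<in>wtuples k k. (-1) ^ tsum k t / of_nat (tsum k t) * of_nat (multinom k t)
          * (\<Prod>i=1..k. Epoly s n x i ^ t i))
      / (\<Sum>t\<in>wtuples s k. (-1) ^ tsum s t / of_nat (tsum s t) * of_nat (multinom s t))
    \<and> (\<Sum>i=1..n. x i ^ k) =
      (\<Sum>t\<in>wtuples k k. (-1) ^ (1 + tsum k t) / of_nat (tsum k t) * of_nat (multinom k t)
          * (\<Prod>i=1..k. Hpoly s n x i ^ t i))
      / (\<Sum>t\<in>wtuples s k. (-1) ^ (k + tsum s t) / of_nat (tsum s t) * of_nat (multinom s t))"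
proof -
  let ?L = "fps_log (fps_geom s) $ k :: 'a ratfun"
  \<comment> \<open>The value is -s/k or 1/k; the first is nonzero because
    \<open>s \<ge> 1\<close>.\<close>
  have L: "?L \<noteq> 0"
    using assms by (simp add: fps_log_geom_nth)
  have D: "(\<Sum>t\<in>wtuples s k. (-1) ^ tsum s t / of_nat (tsum s t) * of_nat (multinom s t)) = - ?L"
    using wtuples_sum_eq_fps_log[of "fps_geom s" k s "\<lambda>_. 1 :: 'a ratfun"]
    by (simp add: fps_geom_nth)
  have D': "(\<Sum>t\<in>wtuples s k. (-1) ^ (k + tsum s t) / of_nat (tsum s t) * of_nat (multinom s t))
      = - ((-1) ^ k * ?L)"
    using arg_cong[OF D, of "\<lambda>y. (-1) ^ k * y"]
    by (simp add: sum_distrib_left power_add mult.assoc)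
  have N': "(\<Sum>t\<in>wtuples k k. (-1) ^ (1 + tsum k t) / of_nat (tsum k t) * of_nat (multinom k t)
      * (\<Prod>i=1..k. Hpoly s n x i ^ t i)) = - ((-1) ^ k * (\<Sum>i=1..n. x i ^ k) * ?L)"
    unfolding Hpoly_sum_eq[symmetric] by (simp add: sum_negf)
  \<comment> \<open>Each quotient is now the power sum times a nonzero factor, divided by that same
    factor.\<close>
  show ?thesis
    unfolding Epoly_sum_eq N' D D' using L by simp
qed

end
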